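(* Let $E$ be a Banach space and suppose that $f\colon[0,\infty)\to E$ is uniformly continuous and such that $\lim_{t\to\infty}\int_0^t f(\tau)\,\mathrm{d}\tau$ exists (in the norm of $E$). Then $\lim_{t\to\infty}f(t)=0$ holds. *)

theory Defs
  imports "HOL-Analysis.Analysis"
begin

end

theory Submission
  imports Defs
begin

text \<open>
  If \<open>f\<close> varies by at most \<open>e / 2\<close> over intervals of a fixed length \<open>h\<close>, then \<open>h f(t)\<close>
  differs from the integral of \<open>f\<close> over \<open>[t, t + h]\<close> by at most \<open>h e / 2\<close>. By the Cauchy
  criterion this integral is eventually smaller than \<open>h e / 2\<close>, so that \<open>f(t)\<close> has norm
  less than \<open>e\<close>.
\<close>

text \<open>The difference is the integral of \<open>f x - c\<close> over \<open>{a..b}\<close>,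
  whose integrand is bounded in norm by \<open>e\<close>.\<close>

lemma norm_integral_diff_scaleR_le:
  fixes f :: "real \<Rightarrow> 'e::banach"
  assumes "f integrable_on {a..b}" "a \<le> b"
    and "\<And>x. x \<in> {a..b} \<Longrightarrow> norm (f x - c) \<le> e"
  shows "norm (integral {a..b} f - (b - a) *\<^sub>R c) \<le> e * (b - a)"
proof -
  have "((\<lambda>x. f x - c) has_integral integral {a..b} f - (b - a) *\<^sub>R c) {a..b}"
    using assms has_integral_const_real[of c a b]
    by (intro has_integral_diff integrable_integral) auto
  \<comment> \<open>The integral bound requires this; it follows from the hypothesis at the point
    \<open>a\<close>.\<close>
  moreover have "0 \<le> e"
    using assms(2) assms(3)[of a] order_trans[OF norm_ge_zero] by auto
  ultimately show ?thesis
    using has_integral_bound_real[of e "{}" "\<lambda>x. f x - c" _ a b] assms(2,3) by auto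
qed

theorem theorem4:
  fixes f :: "real \<Rightarrow> 'e::banach"
  assumes "uniformly_continuous_on {0..} f"
    and "\<exists>L. ((\<lambda>t. integral {0..t} f) \<longlongrightarrow> L) at_top"
  shows "(f \<longlongrightarrow> 0) at_top"
proof (rule tendstoI)
  fix e :: real
  assume "0 < e"
  obtain L where L: "((\<lambda>t. integral {0..t} f) \<longlongrightarrow> L) at_top"
    using assms(2) by blast
  obtain d where "0 < d"
    and d: "\<And>x y. \<lbrakk>x \<in> {0..}; y \<in> {0..}; dist y x < d\<rbrakk> \<Longrightarrow> dist (f y) (f x) < e / 2"
    using assms(1) \<open>0 < e\<close> unfolding uniformly_continuous_on_def by (meson half_gt_zero)
  \<comment> \<open>Strictly below \<open>d\<close>, so that the endpoint \<open>t + h\<close> of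
    the closed interval is still within the modulus of continuity.\<close>
  define h where "h = d / 2"
  have "0 < h" "h < d"
    using \<open>0 < d\<close> by (auto simp: h_def)
  have f_int: "f integrable_on {a..b}" if "0 \<le> a" for a b
    using that uniformly_continuous_imp_continuous[OF assms(1)]
    by (intro integrable_continuous_real) (auto elim: continuous_on_subset)
  have "filterlim (\<lambda>t. t + h) at_top at_top"
    using filterlim_tendsto_add_at_top[OF tendsto_const filterlim_ident, of h]
    by (simp add: add.commute)
  then have "((\<lambda>t. integral {0..t + h} f - integral {0..t} f) \<longlongrightarrow> L - L) at_top"
    by (intro tendsto_diff L filterlim_compose[OF L])
  then have "\<forall>\<^sub>F t in at_top. norm (integral {0..t + h} f - integral {0..t} f) < h * e / 2"
    using \<open>0 < h\<close> \<open>0 < e\<close> by (auto dest!: tendstoD[where e = "h * e / 2"])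
  then show "\<forall>\<^sub>F t in at_top. dist (f t) 0 < e"
    using eventually_ge_at_top[of 0]
  proof eventually_elim
    case (elim t)
    have "integral {0..t + h} f - integral {0..t} f = integral {t..t + h} f"
      using Henstock_Kurzweil_Integration.integral_combine[of 0 t "t + h" f] f_int elim(2) \<open>0 < h\<close>
      by (simp add: algebra_simps)
    moreover have "norm (integral {t..t + h} f - (t + h - t) *\<^sub>R f t) \<le> e / 2 * (t + h - t)"
    proof (rule norm_integral_diff_scaleR_le)
      fix x assume "x \<in> {t..t + h}"
      then show "norm (f x - f t) \<le> e / 2"
        using d[of t x] elim(2) \<open>h < d\<close> by (auto simp: dist_norm)
    qed (use f_int elim(2) \<open>0 < h\<close> in auto)
    \<comment> \<open>The integral and the deviation from it contribute \<open>h * e / 2\<close>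
      each; strictness comes from the integral.\<close>
    ultimately have "norm (h *\<^sub>R f t) < h * e"
      using elim(1) norm_triangle_sub[of "h *\<^sub>R f t" "integral {t..t + h} f"]
      by (simp add: norm_minus_commute mult.commute)
    then show ?case
      using \<open>0 < h\<close> by simp
  qed
qed

end
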